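(* Let $\nu\in\Delta_{\mathcal X}$ and let $C$ be a convex closed subset of $\Delta_{\mathcal X}$ with support $\mathcal X$. Then $$\hat\ell_{\mathcal F}=-\hat\ell_{\mathcal P},$$ $S_{\mathcal F}$ is a nonempty convex compact set, and $\hat\mu(-\hat y_{\mathcal F})=1$ for every $\hat y_{\mathcal F}\in S_{\mathcal F}$. Moreover, if we put $$\hat y^a_{\mathcal F}=\frac{\nu^a}{\hat q^a_{\mathcal P}}-1^a,$$ then $(\hat y^a_{\mathcal F},-1^p)\in S_{\mathcal F}$ and the following hold: (a) If $\sum\hat q^a_{\mathcal P}=1$ then $\bar\mu(-\hat y^a_{\mathcal F})=1$ and $$S_{\mathcal F}=\{\hat y^a_{\mathcal F}\}\times\{y^p\in C^{*p}(\hat y^a_{\mathcal F}):\ \min(y^p)\ge -1\}.$$ (b) If $\sum\hat q^a_{\mathcal P}<1$ then $\bar\mu(-\hat y^a_{\mathcal F})<1$ and $$S_{\mathcal F}=\{\hat y^a_{\mathcal F}\}\times\{y^p\in C^{*p}(\hat y^a_{\mathcal F}):\ \min(y^p)=-1\}.$$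
   Context: $\mathcal X$ is a finite nonempty set with $m$ elements; $\mathbb R^m$ is identified with $\mathbb R^{\mathcal X}$. Relations and functions of vectors are componentwise, $\sum x$ is the sum of the coordinates of $x$, $\max(x)$, $\min(x)$ are the largest and smallest coordinates, and $\langle\cdot,\cdot\rangle$ is the scalar product. $\Delta_{\mathcal X}=\{q\in\mathbb R^m: q\ge 0,\ \sum q=1\}$. Conventions: $\log 0=-\infty$, $0\cdot(-\infty)=0$. For $\nu\in\Delta_{\mathcal X}$ the active and passive alphabets are $\mathcal X^a=\{i:\nu_i>0\}$, $\mathcal X^p=\{i:\nu_i=0\}$, with $m_a,m_p$ elements ($\mathbb R^0=\{0\}$). Write $x=(x^a,x^p)\in\mathbb R^{m_a}\times\mathbb R^{m_p}$ for the projections of $x\in\mathbb R^m$ to the active and passive coordinates; $1^a$, $-1^p$ denote constant vectors in $\mathbb R^{m_a},\mathbb R^{m_p}$. For $M\subseteq\mathbb R^m$, $M^p(x^a)=\{x^p:(x^a,x^p)\in M\}$. If $\mathcal X^p=\emptyset$, then $\max$ and $\min$ over passive coordinates are $-\infty$ and $+\infty$ respectively. The support of $C$ is $\{i\in\mathcal X:\ q_i>0\text{ for some }q\in C\}$. Primal problem: $\ell(q)=-\langle\nu,\log q\rangle$ for $q\in\Delta_{\mathcal X}$, $\hat\ell_{\mathcal P}=\inf_{q\in C}\ell(q)$, $S_{\mathcal P}=\{\hat q\in C:\ell(\hat q)=\hat\ell_{\mathcal P}\}$. It is known that $S_{\mathcal P}\neq\emptyset$ and that all elements of $S_{\mathcal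 P}$ have the same active projection, denoted $\hat q^a_{\mathcal P}$, with $\hat q^a_{\mathcal P}>0$. Fenchel dual problem: $C^*=\{y\in\mathbb R^m:\langle y,q\rangle\le 0\text{ for every }q\in C\}$, $\ell^*(z)=\sup_{q\in\Delta_{\mathcal X}}(\langle q,z\rangle-\ell(q))$, $\hat\ell_{\mathcal F}=\inf_{y\in C^*}\ell^*(-y)$, $S_{\mathcal F}=\{\hat y\in C^*:\ell^*(-\hat y)=\hat\ell_{\mathcal F}\}$. $C^{*p}(y^a)$ is the slice $\{y^p:(y^a,y^p)\in C^*\}$. For $z\in\mathbb R^m$, $\bar\mu(z^a)$ is the unique $\mu>\max(z^a)$ with $\sum\frac{\nu^a}{\mu-z^a}=1$, and $\hat\mu(z)=\max\{\bar\mu(z^a),\max(z^p)\}$. *)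

theory Defs
  imports "HOL-Analysis.Analysis"
begin

text \<open>
  The alphabet is a finite type \<open>'n\<close>. For a subset \<open>I\<close> of the alphabet, the space of real vectors
  indexed by \<open>I\<close> is represented by the extensional functions \<open>I \<rightarrow>\<^sub>E UNIV\<close>; for \<open>I = {}\<close> this is
  a one-point space.
\<close>

definition prob_simplex :: "(real^'n) set" where
  "prob_simplex = {q. (\<forall>i. 0 \<le> q $ i) \<and> (\<Sum>i\<in>UNIV. q $ i) = 1}"

definition active_letters :: "real^'n \<Rightarrow> 'n set" where
  "active_letters \<nu> = {i. \<nu> $ i > 0}"

definition passive_letters :: "real^'n \<Rightarrow> 'n set" where
  "passive_letters \<nu> = {i. \<nu> $ i = 0}"

definition proj_on :: "'n set \<Rightarrow> real^'n \<Rightarrow> 'n \<Rightarrow> real" where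
  "proj_on I x = (\<lambda>i\<in>I. x $ i)"

text \<open>The vector \<open>(x\<^sup>a, x\<^sup>p)\<close> with given active and passive parts.\<close>

definition join_parts :: "real^'n \<Rightarrow> ('n \<Rightarrow> real) \<Rightarrow> ('n \<Rightarrow> real) \<Rightarrow> real^'n" where
  "join_parts \<nu> u v = (\<chi> i. if i \<in> active_letters \<nu> then u i else v i)"

definition passive_slice :: "real^'n \<Rightarrow> (real^'n) set \<Rightarrow> ('n \<Rightarrow> real) \<Rightarrow> ('n \<Rightarrow> real) set" where
  "passive_slice \<nu> M u = {v \<in> passive_letters \<nu> \<rightarrow>\<^sub>E UNIV. join_parts \<nu> u v \<in> M}"

text \<open>
  Largest and smallest coordinate. The extended-real supremum and infimum are attained when the
  finite set \<open>I\<close> is nonempty, and are \<open>-\<infinity>\<close> and \<open>\<infinity>\<close> for \<open>I = {}\<close>.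
\<close>

definition max_coord :: "'n::finite set \<Rightarrow> ('n \<Rightarrow> real) \<Rightarrow> ereal" where
  "max_coord I u = (SUP i\<in>I. ereal (u i))"

definition min_coord :: "'n::finite set \<Rightarrow> ('n \<Rightarrow> real) \<Rightarrow> ereal" where
  "min_coord I u = (INF i\<in>I. ereal (u i))"

definition support_of :: "(real^'n) set \<Rightarrow> 'n set" where
  "support_of C = {i. \<exists>q\<in>C. q $ i > 0}"

text \<open>Only used for nonnegative arguments.\<close>

definition elog :: "real \<Rightarrow> ereal" where
  "elog x = (if x \<le> 0 then -\<infinity> else ereal (ln x))"

text \<open>On \<open>ereal\<close>, \<open>0 * (-\<infinity>) = 0\<close>; on the simplex no summand is \<open>\<infinity>\<close>.\<close>

definition loss :: "real^'n \<Rightarrow> real^'n \<Rightarrow> ereal" where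
  "loss \<nu> q = - (\<Sum>i\<in>UNIV. ereal (\<nu> $ i) * elog (q $ i))"

definition primal_value :: "real^'n \<Rightarrow> (real^'n) set \<Rightarrow> ereal" where
  "primal_value \<nu> C = (INF q\<in>C. loss \<nu> q)"

definition primal_solutions :: "real^'n \<Rightarrow> (real^'n) set \<Rightarrow> (real^'n) set" where
  "primal_solutions \<nu> C = {q \<in> C. loss \<nu> q = primal_value \<nu> C}"

text \<open>The active projection shared by all primal solutions.\<close>

definition primal_active :: "real^'n \<Rightarrow> (real^'n) set \<Rightarrow> 'n \<Rightarrow> real" where
  "primal_active \<nu> C = (THE u. u \<in> proj_on (active_letters \<nu>) ` primal_solutions \<nu> C)"

definition polar_cone :: "(real^'n) set \<Rightarrow> (real^'n) set" where
  "polar_cone C = {y. \<forall>q\<in>C. y \<bullet> q \<le> 0}"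

text \<open>The convex conjugate of the loss restricted to the simplex, where the loss is nonnegative.\<close>

definition loss_conj :: "real^'n \<Rightarrow> real^'n \<Rightarrow> ereal" where
  "loss_conj \<nu> z = (SUP q\<in>prob_simplex. ereal (q \<bullet> z) - loss \<nu> q)"

definition dual_value :: "real^'n \<Rightarrow> (real^'n) set \<Rightarrow> ereal" where
  "dual_value \<nu> C = (INF y\<in>polar_cone C. loss_conj \<nu> (- y))"

definition dual_solutions :: "real^'n \<Rightarrow> (real^'n) set \<Rightarrow> (real^'n) set" where
  "dual_solutions \<nu> C = {y \<in> polar_cone C. loss_conj \<nu> (- y) = dual_value \<nu> C}"

definition mu_bar :: "real^'n \<Rightarrow> ('n \<Rightarrow> real) \<Rightarrow> real" where
  "mu_bar \<nu> u = (THE \<mu>.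
     ereal \<mu> > max_coord (active_letters \<nu>) u
     \<and> (\<Sum>i\<in>active_letters \<nu>. \<nu> $ i / (\<mu> - u i)) = 1)"

definition mu_hat :: "real^'n \<Rightarrow> real^'n \<Rightarrow> ereal" where
  "mu_hat \<nu> z =
     max (ereal (mu_bar \<nu> (proj_on (active_letters \<nu>) z)))
         (max_coord (passive_letters \<nu>) (proj_on (passive_letters \<nu>) z))"

definition dual_active :: "real^'n \<Rightarrow> (real^'n) set \<Rightarrow> 'n \<Rightarrow> real" where
  "dual_active \<nu> C = (\<lambda>i\<in>active_letters \<nu>. \<nu> $ i / primal_active \<nu> C i - 1)"

end

theory Submission
  imports Defs
begin

text \<open>
  Let \<open>p\<close> be a primal solution; it exists because \<open>C\<close> is compact, and it is positive on the active
  letters because \<open>C\<close> contains a point with all coordinates positive. The whole theorem comes from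
  comparing first-order optimality conditions at \<open>p\<close> in two sets.

  On \<open>C\<close>, optimality of \<open>p\<close> says \<open>\<Sum> \<nu> q / p \<le> 1\<close> for \<open>q \<in> C\<close>, the sum being over active letters
  (\<open>primal_variational_inequality\<close>). This means exactly that the vector with active part
  \<open>\<nu> / p - 1\<close> and passive part \<open>-1\<close> lies in the polar cone. By \<open>ln x \<le> x - 1\<close> the conjugate at its
  negative is at most minus the primal value; weak duality gives the reverse, so there is no
  duality gap. Strictness in \<open>ln x \<le> x - 1\<close> for \<open>x \<noteq> 1\<close> also makes the active part of \<open>p\<close> unique.

  On the simplex, let \<open>y\<close> be any dual solution. Absence of a gap forces \<open>\<langle>p, y\<rangle> = 0\<close>, so \<open>p\<close>
  maximizes \<open>\<Sum> \<nu> ln q - \<langle>q, y\<rangle>\<close> over the simplex. The first-order condition towards the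
  vertices gives \<open>y \<ge> \<nu> / p - 1\<close> in every coordinate, with \<open>\<nu> / p\<close> read as \<open>0\<close> on passive letters.
  Averaged with weights \<open>p\<close>, both sides give \<open>0\<close>; hence equality holds wherever \<open>p > 0\<close>
  (\<open>dual_solution_eq\<close>). Since the conjugate at \<open>- y\<close> decreases in \<open>y\<close>, the dual solutions are
  precisely the polar vectors with active part \<open>\<nu> / p - 1\<close> and passive part at least \<open>-1\<close>
  (\<open>dual_solutions_iff\<close>).

  The case distinction is whether \<open>p\<close> charges a passive letter. If it does, the coordinate of \<open>y\<close> there
  is \<open>-1\<close>, so the minimum in (b) is attained automatically. The sum of \<open>\<nu> / (\<mu> - u)\<close> for
  \<open>u = 1 - \<nu> / p\<close> takes at \<open>\<mu> = 1\<close> the value \<open>\<Sum> p\<close> over the active letters and strictly decreases in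
  \<open>\<mu>\<close>, which compares its solution with \<open>1\<close>.
\<close>

section \<open>Loss and first-order condition\<close>

definition log_lik :: "real^'n \<Rightarrow> real^'n \<Rightarrow> real" where
  "log_lik \<nu> q = (\<Sum>i\<in>active_letters \<nu>. \<nu> $ i * ln (q $ i))"

lemma simplex_nonneg: "q \<in> prob_simplex \<Longrightarrow> 0 \<le> q $ i"
  by (simp add: prob_simplex_def)

lemma simplex_sum: "q \<in> prob_simplex \<Longrightarrow> (\<Sum>i\<in>UNIV. q $ i) = 1"
  by (simp add: prob_simplex_def)

lemma passive_eq_Compl_active:
  "\<nu> \<in> prob_simplex \<Longrightarrow> passive_letters \<nu> = - active_letters \<nu>"
  unfolding passive_letters_def active_letters_def
  using simplex_nonneg[of \<nu>] by (force simp: less_le)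

lemma sum_split_letters:
  fixes f :: "'n::finite \<Rightarrow> 'b::comm_monoid_add"
  assumes "\<nu> \<in> prob_simplex"
  shows "(\<Sum>i\<in>UNIV. f i) = (\<Sum>i\<in>active_letters \<nu>. f i) + (\<Sum>i\<in>passive_letters \<nu>. f i)"
proof -
  have "UNIV = active_letters \<nu> \<union> passive_letters \<nu>"
    using passive_eq_Compl_active[OF assms] by auto
  then have "(\<Sum>i\<in>UNIV. f i) = (\<Sum>i\<in>active_letters \<nu> \<union> passive_letters \<nu>. f i)"
    by simp
  also have "\<dots> = (\<Sum>i\<in>active_letters \<nu>. f i) + (\<Sum>i\<in>passive_letters \<nu>. f i)"
    using passive_eq_Compl_active[OF assms] by (intro sum.union_disjoint) auto
  finally show ?thesis .
qed

lemma sum_active_nu: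
  assumes "\<nu> \<in> prob_simplex"
  shows "(\<Sum>i\<in>active_letters \<nu>. \<nu> $ i) = 1"
  using sum_split_letters[OF assms, of "\<lambda>i. \<nu> $ i"] simplex_sum[OF assms]
  by (simp add: passive_letters_def)

lemma active_nonempty: "\<nu> \<in> prob_simplex \<Longrightarrow> active_letters \<nu> \<noteq> {}"
  using sum_active_nu by fastforce

text \<open>The inequality \<open>ln x \<le> x - 1\<close>, averaged over the ratios \<open>q / p\<close> with weights \<open>\<nu>\<close>. It turns
  the supremum over \<open>q\<close> defining the conjugate into a linear estimate.\<close>

lemma log_lik_ratio_le:
  assumes \<nu>: "\<nu> \<in> prob_simplex"
    and q: "\<And>i. i \<in> active_letters \<nu> \<Longrightarrow> 0 < q $ i"
    and p: "\<And>i. i \<in> active_letters \<nu> \<Longrightarrow> 0 < p $ i"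
  shows "log_lik \<nu> q - log_lik \<nu> p \<le> (\<Sum>i\<in>active_letters \<nu>. \<nu> $ i * (q $ i / p $ i)) - 1"
proof -
  have "\<nu> $ i * ln (q $ i) - \<nu> $ i * ln (p $ i) \<le> \<nu> $ i * (q $ i / p $ i) - \<nu> $ i"
    if i: "i \<in> active_letters \<nu>" for i
    using mult_left_mono[OF ln_le_minus_one[of "q $ i / p $ i"] simplex_nonneg[OF \<nu>, of i]]
      q[OF i] p[OF i] by (simp add: ln_div right_diff_distrib)
  then have "(\<Sum>i\<in>active_letters \<nu>. \<nu> $ i * ln (q $ i) - \<nu> $ i * ln (p $ i))
      \<le> (\<Sum>i\<in>active_letters \<nu>. \<nu> $ i * (q $ i / p $ i) - \<nu> $ i)"
    by (rule sum_mono)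
  then show ?thesis
    by (simp add: sum_subtractf log_lik_def sum_active_nu[OF \<nu>])
qed

lemma loss_eq_log_lik:
  assumes "\<nu> \<in> prob_simplex" "\<And>i. i \<in> active_letters \<nu> \<Longrightarrow> 0 < q $ i"
  shows "loss \<nu> q = ereal (- log_lik \<nu> q)"
proof -
  have "(\<Sum>i\<in>UNIV. ereal (\<nu> $ i) * elog (q $ i))
      = (\<Sum>i\<in>active_letters \<nu>. ereal (\<nu> $ i) * elog (q $ i))
        + (\<Sum>i\<in>passive_letters \<nu>. ereal (\<nu> $ i) * elog (q $ i))"
    by (rule sum_split_letters[OF assms(1)])
  also have "(\<Sum>i\<in>passive_letters \<nu>. ereal (\<nu> $ i) * elog (q $ i)) = 0"
    by (intro sum.neutral) (simp add: passive_letters_def)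
  also have "(\<Sum>i\<in>active_letters \<nu>. ereal (\<nu> $ i) * elog (q $ i))
      = (\<Sum>i\<in>active_letters \<nu>. ereal (\<nu> $ i * ln (q $ i)))"
    by (intro sum.cong refl) (use assms(2) in \<open>force simp: elog_def not_le\<close>)
  finally show ?thesis
    by (simp add: loss_def log_lik_def)
qed

lemma loss_eq_infinity:
  assumes "\<nu> \<in> prob_simplex" "i \<in> active_letters \<nu>" "q $ i \<le> 0"
  shows "loss \<nu> q = \<infinity>"
proof -
  have "(\<Sum>i\<in>UNIV. ereal (\<nu> $ i) * elog (q $ i)) = -\<infinity>"
  proof -
    have "ereal (\<nu> $ i) * elog (q $ i) = -\<infinity>"
      using assms by (simp add: elog_def active_letters_def)
    moreover have "ereal (\<nu> $ j) * elog (q $ j) \<noteq> \<infinity>" for j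
      using simplex_nonneg[OF assms(1), of j] by (auto simp: elog_def)
    ultimately show ?thesis
      by (subst sum.remove[of _ i]) (auto simp: sum_Pinfty)
  qed
  then show ?thesis by (simp add: loss_def)
qed

text \<open>
  A one-sided derivative at \<open>t = 0\<close> of a weighted log-likelihood along a segment from \<open>p\<close> to \<open>q\<close>,
  with a linear penalty \<open>t * c\<close>. It is used with \<open>c = 0\<close> on \<open>C\<close>, and with \<open>c\<close> a coordinate of a
  dual solution on the simplex. The end point \<open>t = 1\<close> is excluded
  because coordinates of \<open>q\<close> may vanish.
\<close>

lemma first_order_condition:
  fixes c :: real
  assumes fin: "finite I"
    and w: "\<And>i. i \<in> I \<Longrightarrow> 0 \<le> w i"
    and p: "\<And>i. i \<in> I \<Longrightarrow> 0 < p i"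
    and q: "\<And>i. i \<in> I \<Longrightarrow> 0 \<le> q i"
    and max: "\<And>t. 0 < t \<Longrightarrow> t < 1 \<Longrightarrow>
      (\<Sum>i\<in>I. w i * ln ((1 - t) * p i + t * q i)) - t * c \<le> (\<Sum>i\<in>I. w i * ln (p i))"
  shows "(\<Sum>i\<in>I. w i * (q i / p i - 1)) \<le> c"
proof -
  define g where "g t = (\<Sum>i\<in>I. w i * ((q i / p i - 1) / (1 + t * (q i / p i - 1))))" for t
  have "g t \<le> c" if t: "0 < t" "t < 1" for t
  proof -
    \<comment> \<open>The lower bound \<open>ln s \<ge> 1 - 1 / s\<close> at \<open>s = 1 + t (q / p - 1)\<close> has the right slope at \<open>t = 0\<close>.\<close>
    have *: "w i * (t * ((q i / p i - 1) / (1 + t * (q i / p i - 1))))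
        \<le> w i * ln ((1 - t) * p i + t * q i) - w i * ln (p i)" if i: "i \<in> I" for i
    proof -
      define s where "s = 1 + t * (q i / p i - 1)"
      have "0 \<le> t * (q i / p i)" using p[OF i] q[OF i] t by simp
      then have s: "0 < s" using t by (simp add: s_def algebra_simps)
      have "(1 - t) * p i + t * q i = p i * s"
        using p[OF i] by (simp add: s_def field_simps)
      then have "ln ((1 - t) * p i + t * q i) - ln (p i) = ln s"
        using p[OF i] s by (simp add: ln_mult)
      moreover have "- ln s \<le> 1 / s - 1"
        using ln_le_minus_one[of "1 / s"] s by (simp add: ln_div)
      moreover have "1 - 1 / s = t * ((q i / p i - 1) / s)"
        using s by (simp add: s_def field_simps)
      ultimately have "t * ((q i / p i - 1) / s) \<le> ln ((1 - t) * p i + t * q i) - ln (p i)"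
        by linarith
      from mult_left_mono[OF this w[OF i]] show ?thesis
        by (simp add: s_def right_diff_distrib)
    qed
    have "t * g t \<le> (\<Sum>i\<in>I. w i * ln ((1 - t) * p i + t * q i) - w i * ln (p i))"
      unfolding g_def sum_distrib_left
      by (rule sum_mono) (use * in \<open>simp add: mult.left_commute\<close>)
    also have "\<dots> \<le> t * c"
      using max[OF t] by (simp add: sum_subtractf)
    finally show ?thesis using t by simp
  qed
  then have "\<forall>\<^sub>F t in at_right 0. g t \<le> c"
    unfolding eventually_at_right_field by (intro exI[of _ 1]) auto
  moreover have "(g \<longlongrightarrow> g 0) (at_right 0)"
    unfolding g_def by (intro tendsto_intros) auto
  ultimately have "g 0 \<le> c"
    by (intro tendsto_upperbound) auto
  then show ?thesis by (simp add: g_def)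
qed

lemma join_parts_image:
  assumes "\<nu> \<in> prob_simplex"
  shows "(\<lambda>(u, v). join_parts \<nu> u v) ` ({u} \<times> {v \<in> passive_slice \<nu> M u. R v})
    = {y \<in> M. (\<forall>i\<in>active_letters \<nu>. y $ i = u i) \<and> R (proj_on (passive_letters \<nu>) y)}"
    (is "?L = ?R")
proof (intro set_eqI iffI)
  fix y assume "y \<in> ?L"
  then obtain v where v: "y = join_parts \<nu> u v" "v \<in> passive_slice \<nu> M u" "R v" by auto
  then have "proj_on (passive_letters \<nu>) y = v"
    unfolding proj_on_def join_parts_def passive_slice_def
    using passive_eq_Compl_active[OF assms]
    by (auto simp: fun_eq_iff restrict_def PiE_def extensional_def)
  then show "y \<in> ?R" using v
    by (auto simp: passive_slice_def join_parts_def)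
next
  fix y assume y: "y \<in> ?R"
  then have "y = join_parts \<nu> u (proj_on (passive_letters \<nu>) y)"
    using passive_eq_Compl_active[OF assms]
    by (auto simp: join_parts_def proj_on_def vec_eq_iff)
  moreover from this y have "proj_on (passive_letters \<nu>) y \<in> {v \<in> passive_slice \<nu> M u. R v}"
    by (auto simp: passive_slice_def proj_on_def)
  ultimately show "y \<in> ?L"
    by (intro image_eqI[of _ _ "(u, proj_on (passive_letters \<nu>) y)"]) simp_all
qed

section \<open>The equation for \<open>\<mu>\<close>\<close>

lemma max_coord_less_iff:
  "I \<noteq> {} \<Longrightarrow> max_coord I u < ereal c \<longleftrightarrow> (\<forall>i\<in>I. u i < c)"
  unfolding max_coord_def by (simp add: finite_Sup_less_iff)

lemma mu_sum_strict_antimono: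
  assumes "\<nu> \<in> prob_simplex" "\<And>i. i \<in> active_letters \<nu> \<Longrightarrow> u i < a" "a < b"
  shows "(\<Sum>i\<in>active_letters \<nu>. \<nu> $ i / (b - u i)) < (\<Sum>i\<in>active_letters \<nu>. \<nu> $ i / (a - u i))"
proof (rule sum_strict_mono)
  fix i assume i: "i \<in> active_letters \<nu>"
  show "\<nu> $ i / (b - u i) < \<nu> $ i / (a - u i)"
    using assms(2)[OF i] \<open>a < b\<close> i
    by (intro divide_strict_left_mono) (auto simp: active_letters_def)
qed (use active_nonempty[OF assms(1)] in auto)

lemma mu_bar_eqI:
  assumes \<nu>: "\<nu> \<in> prob_simplex" and less: "\<And>i. i \<in> active_letters \<nu> \<Longrightarrow> u i < \<mu>"
    and eq: "(\<Sum>i\<in>active_letters \<nu>. \<nu> $ i / (\<mu> - u i)) = 1"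
  shows "mu_bar \<nu> u = \<mu>"
  unfolding mu_bar_def
proof (rule the_equality)
  show "max_coord (active_letters \<nu>) u < ereal \<mu> \<and> (\<Sum>i\<in>active_letters \<nu>. \<nu> $ i / (\<mu> - u i)) = 1"
    using less eq max_coord_less_iff[OF active_nonempty[OF \<nu>]] by blast
next
  fix m
  assume "max_coord (active_letters \<nu>) u < ereal m \<and> (\<Sum>i\<in>active_letters \<nu>. \<nu> $ i / (m - u i)) = 1"
  then have m: "\<And>i. i \<in> active_letters \<nu> \<Longrightarrow> u i < m"
      "(\<Sum>i\<in>active_letters \<nu>. \<nu> $ i / (m - u i)) = 1"
    using max_coord_less_iff[OF active_nonempty[OF \<nu>]] by blast+
  show "m = \<mu>"
    using mu_sum_strict_antimono[of \<nu> u m \<mu>] mu_sum_strict_antimono[of \<nu> u \<mu> m] m less eq \<nu>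
    by (cases m \<mu> rule: linorder_cases) auto
qed

lemma mu_bar_less:
  assumes \<nu>: "\<nu> \<in> prob_simplex" and less: "\<And>i. i \<in> active_letters \<nu> \<Longrightarrow> u i < c"
    and sum_less: "(\<Sum>i\<in>active_letters \<nu>. \<nu> $ i / (c - u i)) < 1"
  shows "mu_bar \<nu> u < c"
proof -
  let ?A = "active_letters \<nu>"
  let ?g = "\<lambda>m. \<Sum>i\<in>?A. \<nu> $ i / (m - u i)"
  have "Max (u ` ?A) \<in> u ` ?A"
    using active_nonempty[OF \<nu>] by (intro Max_in) auto
  then obtain j where j: "j \<in> ?A" "u j = Max (u ` ?A)" by auto
  have le: "u i \<le> u j" if "i \<in> ?A" for i
    using that by (simp add: j(2))
  \<comment> \<open>At \<open>a\<close> the summand of the largest coordinate alone is \<open>1\<close>, so a solution lies in \<open>[a, c]\<close>.\<close>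
  define a where "a = u j + \<nu> $ j"
  have \<nu>j: "0 < \<nu> $ j" using j(1) by (simp add: active_letters_def)
  have a: "u i < a" if "i \<in> ?A" for i
    using le[OF that] \<nu>j by (simp add: a_def)
  have "\<nu> $ j / (a - u j) \<le> ?g a"
    using j(1) a by (intro member_le_sum) (auto simp: active_letters_def less_imp_le)
  then have ga: "1 \<le> ?g a" using \<nu>j by (simp add: a_def)
  have "a < c"
  proof (rule ccontr)
    assume "\<not> a < c"
    then have "?g a \<le> ?g c"
      using mu_sum_strict_antimono[of \<nu> u c a] \<nu> less by (cases "a = c") fastforce+
    then show False using ga sum_less by simp
  qed
  have "continuous_on {a..c} ?g"
    by (intro continuous_intros) (use a in fastforce)
  then obtain m where m: "a \<le> m" "m \<le> c" "?g m = 1"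
    using IVT2'[of ?g c 1 a] ga sum_less \<open>a < c\<close> by auto
  have "mu_bar \<nu> u = m"
    using m a by (intro mu_bar_eqI[OF \<nu>]) (auto intro: less_le_trans)
  moreover have "m \<noteq> c" using m sum_less by auto
  ultimately show ?thesis using m by simp
qed

section \<open>Primal solutions\<close>

lemma bounded_if_coords_bounded:
  fixes S :: "(real^'n) set"
  assumes "\<And>x i. x \<in> S \<Longrightarrow> \<bar>x $ i\<bar> \<le> B i"
  shows "bounded S"
proof (rule boundedI)
  fix x assume "x \<in> S"
  then show "norm x \<le> (\<Sum>i\<in>UNIV. B i)"
    by (intro order_trans[OF norm_le_l1_cart] sum_mono assms)
qed

locale primal_problem =
  fixes \<nu> :: "real^'n" and C :: "(real^'n) set"
  assumes \<nu>: "\<nu> \<in> prob_simplex"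
    and convex: "convex C" and closed: "closed C" and subset: "C \<subseteq> prob_simplex"
    and support: "support_of C = UNIV"
begin

text \<open>The barycentre of one point of \<open>C\<close> per letter, each positive at its letter. It keeps the primal value
  finite and makes the set of dual solutions bounded above.\<close>

lemma positive_point:
  obtains q where "q \<in> C" "\<And>i. 0 < q $ i"
proof -
  have "\<forall>i. \<exists>q\<in>C. 0 < q $ i"
    using support unfolding support_of_def by blast
  then obtain r where r: "\<And>i. r i \<in> C" "\<And>i. 0 < r i $ i" by metis
  let ?q = "\<Sum>j\<in>UNIV. (1 / real CARD('n)) *\<^sub>R r j"
  have "?q \<in> C"
    by (rule convex_sum[OF _ convex]) (auto simp: r)
  moreover have "0 < ?q $ i" for i
  proof -
    have "0 < (\<Sum>j\<in>UNIV. r j $ i)"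
      using r(2)[of i] simplex_nonneg subset r(1) by (intro sum_pos2[of _ i]) auto
    then show ?thesis by (simp add: sum_divide_distrib[symmetric])
  qed
  ultimately show ?thesis by (rule that)
qed

lemma compact_C: "compact C"
proof -
  have "\<bar>q $ i\<bar> \<le> 1" if "q \<in> C" for q i
  proof -
    have q: "q \<in> prob_simplex" using that subset by auto
    then have "q $ i \<le> (\<Sum>i\<in>UNIV. q $ i)"
      by (intro member_le_sum) (auto simp: simplex_nonneg)
    then show ?thesis using q by (simp add: simplex_nonneg simplex_sum)
  qed
  then have "bounded C" by (rule bounded_if_coords_bounded)
  then show ?thesis using closed compact_eq_bounded_closed by blast
qed

text \<open>The loss is infinite where an active coordinate vanishes, but the likelihood
  \<open>\<Prod> q powr \<nu>\<close> is continuous on \<open>C\<close>, so a maximizer of it is taken.\<close>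

lemma exists_primal_solution:
  obtains p where "p \<in> primal_solutions \<nu> C" "p \<in> C" "\<And>i. i \<in> active_letters \<nu> \<Longrightarrow> 0 < p $ i"
proof -
  let ?A = "active_letters \<nu>"
  let ?F = "\<lambda>q::real^'n. \<Prod>i\<in>?A. (q $ i) powr (\<nu> $ i)"
  obtain q0 where q0: "q0 \<in> C" "\<And>i. 0 < q0 $ i" by (rule positive_point) blast
  have "continuous_on C ?F"
    using subset simplex_nonneg
    by (intro continuous_on_prod continuous_on_powr' continuous_intros)
       (auto simp: active_letters_def)
  then obtain p where p: "p \<in> C" "\<And>q. q \<in> C \<Longrightarrow> ?F q \<le> ?F p"
    using continuous_attains_sup[OF compact_C] q0(1) by blast
  have "0 < ?F q0" using q0(2) by (intro prod_pos) (simp add: less_imp_neq[symmetric])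
  then have Fp: "0 < ?F p" using p(2)[OF q0(1)] by simp
  have pos: "0 < p $ i" if "i \<in> ?A" for i
  proof -
    have "(p $ i) powr (\<nu> $ i) \<noteq> 0"
      using Fp that by (metis finite less_irrefl prod_zero_iff)
    then show ?thesis using simplex_nonneg[of p i] p(1) subset by (auto simp: less_le)
  qed
  have lnF: "ln (?F q) = log_lik \<nu> q" if "\<And>i. i \<in> ?A \<Longrightarrow> 0 < q $ i" for q
  proof -
    have "ln (?F q) = (\<Sum>i\<in>?A. ln ((q $ i) powr (\<nu> $ i)))"
      by (rule ln_prod) (use that in \<open>simp_all add: less_imp_neq[symmetric]\<close>)
    also have "\<dots> = log_lik \<nu> q"
      unfolding log_lik_def by (intro sum.cong refl) (simp add: ln_powr)
    finally show ?thesis .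
  qed
  have min: "loss \<nu> p \<le> loss \<nu> q" if q: "q \<in> C" for q
  proof (cases "\<forall>i\<in>?A. 0 < q $ i")
    case True
    have "0 < ?F q" using True by (intro prod_pos) fastforce
    then have "log_lik \<nu> q \<le> log_lik \<nu> p"
      using p(2)[OF q] Fp lnF[of q] lnF[of p] True pos by (metis ln_le_cancel_iff)
    then show ?thesis using True pos by (simp add: loss_eq_log_lik[OF \<nu>])
  next
    case False
    then obtain i where "i \<in> ?A" "q $ i \<le> 0" by (auto simp: not_less)
    then show ?thesis using loss_eq_infinity[OF \<nu>] by simp
  qed
  have "loss \<nu> p = primal_value \<nu> C"
    unfolding primal_value_def by (intro antisym INF_greatest INF_lower min p(1))
  then show ?thesis using p(1) pos by (intro that) (auto simp: primal_solutions_def)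
qed

lemma primal_solution_pos:
  assumes "p \<in> primal_solutions \<nu> C" "i \<in> active_letters \<nu>"
  shows "0 < p $ i"
proof (rule ccontr)
  assume "\<not> 0 < p $ i"
  then have "loss \<nu> p = \<infinity>" using assms loss_eq_infinity[OF \<nu>] by simp
  moreover obtain r where "r \<in> primal_solutions \<nu> C" "\<And>i. i \<in> active_letters \<nu> \<Longrightarrow> 0 < r $ i"
    by (rule exists_primal_solution) blast
  ultimately show False
    using assms(1) loss_eq_log_lik[OF \<nu>, of r] by (simp add: primal_solutions_def)
qed

lemma primal_value_eq:
  assumes "p \<in> primal_solutions \<nu> C"
  shows "primal_value \<nu> C = ereal (- log_lik \<nu> p)"
  using assms primal_solution_pos[OF assms] loss_eq_log_lik[OF \<nu>, of p]
  by (simp add: primal_solutions_def)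

lemma log_lik_le:
  assumes p: "p \<in> primal_solutions \<nu> C" and q: "q \<in> C" "\<And>i. i \<in> active_letters \<nu> \<Longrightarrow> 0 < q $ i"
  shows "log_lik \<nu> q \<le> log_lik \<nu> p"
proof -
  have "primal_value \<nu> C \<le> loss \<nu> q"
    unfolding primal_value_def by (rule INF_lower[OF q(1)])
  then show ?thesis using primal_value_eq[OF p] loss_eq_log_lik[OF \<nu> q(2)] by simp
qed

lemma primal_variational_inequality:
  assumes p: "p \<in> primal_solutions \<nu> C" and q: "q \<in> C"
  shows "(\<Sum>i\<in>active_letters \<nu>. \<nu> $ i * (q $ i / p $ i)) \<le> 1"
proof -
  let ?A = "active_letters \<nu>"
  have pC: "p \<in> C" using p by (simp add: primal_solutions_def)
  have q0: "0 \<le> q $ i" for i using q subset simplex_nonneg by blast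
  have "(\<Sum>i\<in>?A. \<nu> $ i * (q $ i / p $ i - 1)) \<le> 0"
  proof (rule first_order_condition)
    fix t :: real assume t: "0 < t" "t < 1"
    let ?r = "(1 - t) *\<^sub>R p + t *\<^sub>R q"
    have "?r \<in> C" using convex pC q t by (intro convexD) auto
    moreover have "0 < ?r $ i" if "i \<in> ?A" for i
      using primal_solution_pos[OF p that] t q0[of i] by (simp add: add_pos_nonneg)
    ultimately have "log_lik \<nu> ?r \<le> log_lik \<nu> p" by (rule log_lik_le[OF p])
    then show "(\<Sum>i\<in>?A. \<nu> $ i * ln ((1 - t) * p $ i + t * q $ i)) - t * 0
        \<le> (\<Sum>i\<in>?A. \<nu> $ i * ln (p $ i))"
      by (simp add: log_lik_def)
  qed (use primal_solution_pos[OF p] q0 simplex_nonneg[OF \<nu>] in auto)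
  then show ?thesis
    using sum_active_nu[OF \<nu>] by (simp add: right_diff_distrib sum_subtractf)
qed

text \<open>
  If \<open>q\<close> is another solution, the terms \<open>r - 1 - ln r \<ge> 0\<close> for \<open>r = q / p\<close> have weighted
  sum at most \<open>0\<close>, by the variational inequality and equality of the losses; so \<open>r = 1\<close> throughout.
\<close>

lemma primal_active_eq:
  assumes p: "p \<in> primal_solutions \<nu> C"
  shows "primal_active \<nu> C = proj_on (active_letters \<nu>) p"
  unfolding primal_active_def
proof (rule the_equality)
  show "proj_on (active_letters \<nu>) p \<in> proj_on (active_letters \<nu>) ` primal_solutions \<nu> C"
    using p by simp
next
  let ?A = "active_letters \<nu>"
  fix u assume "u \<in> proj_on ?A ` primal_solutions \<nu> C"
  then obtain q where q: "q \<in> primal_solutions \<nu> C" "u = proj_on ?A q" by auto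
  let ?r = "\<lambda>i. q $ i / p $ i"
  let ?gap = "\<lambda>i. \<nu> $ i * (?r i - 1 - ln (?r i))"
  have r: "0 < ?r i" if "i \<in> ?A" for i
    using that primal_solution_pos p q(1) by simp
  have gap: "0 \<le> ?gap i" if "i \<in> ?A" for i
    using ln_le_minus_one[OF r[OF that]] simplex_nonneg[OF \<nu>] by simp
  have "log_lik \<nu> q = log_lik \<nu> p"
    using primal_value_eq[OF p] primal_value_eq[OF q(1)] by simp
  moreover have "\<nu> $ i * ln (?r i) = \<nu> $ i * ln (q $ i) - \<nu> $ i * ln (p $ i)" if "i \<in> ?A" for i
    using primal_solution_pos[OF p that] primal_solution_pos[OF q(1) that]
    by (simp add: ln_div right_diff_distrib)
  ultimately have "(\<Sum>i\<in>?A. \<nu> $ i * ln (?r i)) = 0"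
    by (simp add: sum_subtractf log_lik_def)
  moreover have "(\<Sum>i\<in>?A. \<nu> $ i * ?r i) \<le> 1"
    using q(1) by (intro primal_variational_inequality[OF p]) (simp add: primal_solutions_def)
  ultimately have "(\<Sum>i\<in>?A. ?gap i) \<le> 0"
    by (simp add: right_diff_distrib sum_subtractf sum_active_nu[OF \<nu>])
  then have "(\<Sum>i\<in>?A. ?gap i) = 0" using gap by (intro antisym sum_nonneg) auto
  then have "?gap i = 0" if "i \<in> ?A" for i
    using that gap by (subst (asm) sum_nonneg_eq_0_iff) auto
  then have "?r i = 1" if "i \<in> ?A" for i
    using that r[OF that] by (intro ln_eq_minus_one) (force simp: active_letters_def)+
  then have "q $ i = p $ i" if "i \<in> ?A" for i using that r[OF that] by fastforce
  then show "u = proj_on ?A p" by (auto simp: q(2) proj_on_def)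
qed

section \<open>Dual solutions\<close>

lemma weak_duality:
  assumes y: "y \<in> polar_cone C"
  shows "- primal_value \<nu> C \<le> loss_conj \<nu> (- y)"
proof -
  obtain p where p: "p \<in> primal_solutions \<nu> C" "p \<in> C" by (rule exists_primal_solution) blast
  have "ereal (p \<bullet> (- y)) - loss \<nu> p \<le> loss_conj \<nu> (- y)"
    unfolding loss_conj_def using p(2) subset by (intro SUP_upper) auto
  moreover have "0 \<le> p \<bullet> (- y)"
    using y p(2) by (simp add: polar_cone_def inner_commute)
  ultimately show ?thesis
    using p(1) primal_value_eq[OF p(1)] by (auto simp: primal_solutions_def elim: order_trans[rotated])
qed

text \<open>
  Since \<open>y \<ge> \<nu> / p - 1\<close>, the pairing \<open>\<langle>q, y\<rangle>\<close> is at least \<open>\<Sum> \<nu> q / p - 1\<close> on the simplex,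
  which is exactly what \<open>ln x \<le> x - 1\<close> needs. Applied to the explicit candidate it closes the duality
  gap; in general it shows that passive coordinates can be raised within the polar cone without
  losing optimality.
\<close>

lemma loss_conj_le:
  assumes p: "p \<in> primal_solutions \<nu> C"
    and ya: "\<And>i. i \<in> active_letters \<nu> \<Longrightarrow> y $ i = \<nu> $ i / p $ i - 1"
    and yp: "\<And>i. i \<in> passive_letters \<nu> \<Longrightarrow> -1 \<le> y $ i"
  shows "loss_conj \<nu> (- y) \<le> - primal_value \<nu> C"
  unfolding loss_conj_def
proof (rule SUP_least)
  let ?A = "active_letters \<nu>" and ?P = "passive_letters \<nu>"
  fix q :: "real^'n" assume q: "q \<in> prob_simplex"
  show "ereal (q \<bullet> (- y)) - loss \<nu> q \<le> - primal_value \<nu> C"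
  proof (cases "\<forall>i\<in>?A. 0 < q $ i")
    case False
    then obtain i where "i \<in> ?A" "q $ i \<le> 0" by (auto simp: not_less)
    then show ?thesis using loss_eq_infinity[OF \<nu>] by simp
  next
    case True
    have "q \<bullet> y = (\<Sum>i\<in>?A. q $ i * y $ i) + (\<Sum>i\<in>?P. q $ i * y $ i)"
      by (simp add: inner_vec_def sum_split_letters[OF \<nu>])
    moreover have "(\<Sum>i\<in>?A. q $ i * y $ i) = (\<Sum>i\<in>?A. \<nu> $ i * (q $ i / p $ i) - q $ i)"
      by (intro sum.cong) (auto simp: ya algebra_simps)
    moreover have "(\<Sum>i\<in>?P. - q $ i) \<le> (\<Sum>i\<in>?P. q $ i * y $ i)"
      using mult_left_mono[OF yp simplex_nonneg[OF q]] by (intro sum_mono) fastforce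
    moreover have "(\<Sum>i\<in>?A. q $ i) + (\<Sum>i\<in>?P. q $ i) = 1"
      using simplex_sum[OF q] sum_split_letters[OF \<nu>, of "\<lambda>i. q $ i"] by simp
    ultimately have "(\<Sum>i\<in>?A. \<nu> $ i * (q $ i / p $ i)) - 1 \<le> q \<bullet> y"
      by (simp add: sum_subtractf sum_negf)
    then have "- (q \<bullet> y) + log_lik \<nu> q \<le> log_lik \<nu> p"
      using log_lik_ratio_le[OF \<nu>, of q p] True primal_solution_pos[OF p] by simp
    then show ?thesis
      using True by (simp add: loss_eq_log_lik[OF \<nu>] primal_value_eq[OF p])
  qed
qed

text \<open>On the simplex, \<open>\<langle>y, q\<rangle> = \<Sum> \<nu> q / p - 1\<close>: membership in the polar cone is the
  variational inequality itself.\<close>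

lemma dual_candidate_in_polar:
  assumes p: "p \<in> primal_solutions \<nu> C"
    and ya: "\<And>i. i \<in> active_letters \<nu> \<Longrightarrow> y $ i = \<nu> $ i / p $ i - 1"
    and yp: "\<And>i. i \<in> passive_letters \<nu> \<Longrightarrow> y $ i = -1"
  shows "y \<in> polar_cone C"
  unfolding polar_cone_def
proof (intro CollectI ballI)
  let ?A = "active_letters \<nu>" and ?P = "passive_letters \<nu>"
  fix q assume q: "q \<in> C"
  have "(\<Sum>i\<in>?A. q $ i) + (\<Sum>i\<in>?P. q $ i) = 1"
    using simplex_sum[of q] q subset sum_split_letters[OF \<nu>, of "\<lambda>i. q $ i"] by auto
  moreover have "(\<Sum>i\<in>?A. y $ i * q $ i) = (\<Sum>i\<in>?A. \<nu> $ i * (q $ i / p $ i) - q $ i)"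
    by (intro sum.cong) (auto simp: ya algebra_simps)
  moreover have "(\<Sum>i\<in>?P. y $ i * q $ i) = (\<Sum>i\<in>?P. - q $ i)"
    by (intro sum.cong) (auto simp: yp)
  ultimately have "y \<bullet> q = (\<Sum>i\<in>?A. \<nu> $ i * (q $ i / p $ i)) - 1"
    by (simp add: inner_vec_def sum_split_letters[OF \<nu>] sum_subtractf sum_negf)
  then show "y \<bullet> q \<le> 0" using primal_variational_inequality[OF p q] by simp
qed

lemma strong_duality: "dual_value \<nu> C = - primal_value \<nu> C"
proof (rule antisym)
  obtain p where p: "p \<in> primal_solutions \<nu> C" by (rule exists_primal_solution) blast
  define y :: "real^'n" where "y = (\<chi> i. if i \<in> active_letters \<nu> then \<nu> $ i / p $ i - 1 else -1)"
  have y: "y $ i = (if i \<in> active_letters \<nu> then \<nu> $ i / p $ i - 1 else -1)" for i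
    by (simp add: y_def)
  have "y \<in> polar_cone C"
    using passive_eq_Compl_active[OF \<nu>] by (intro dual_candidate_in_polar[OF p]) (auto simp: y)
  then have "dual_value \<nu> C \<le> loss_conj \<nu> (- y)"
    unfolding dual_value_def by (rule INF_lower)
  also have "\<dots> \<le> - primal_value \<nu> C"
    using passive_eq_Compl_active[OF \<nu>] by (intro loss_conj_le[OF p]) (auto simp: y)
  finally show "dual_value \<nu> C \<le> - primal_value \<nu> C" .
  show "- primal_value \<nu> C \<le> dual_value \<nu> C"
    unfolding dual_value_def by (intro INF_greatest weak_duality)
qed

lemma dual_solutions_eq_loss_conj_le:
  "dual_solutions \<nu> C = {y \<in> polar_cone C. loss_conj \<nu> (- y) \<le> - primal_value \<nu> C}"
  using weak_duality by (auto simp: dual_solutions_def strong_duality intro: antisym)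

lemma dual_solution_bound:
  assumes p: "p \<in> primal_solutions \<nu> C" and y: "y \<in> dual_solutions \<nu> C"
    and q: "q \<in> prob_simplex" "\<And>i. i \<in> active_letters \<nu> \<Longrightarrow> 0 < q $ i"
  shows "log_lik \<nu> q - q \<bullet> y \<le> log_lik \<nu> p"
proof -
  have "ereal (q \<bullet> (- y)) - loss \<nu> q \<le> loss_conj \<nu> (- y)"
    unfolding loss_conj_def by (rule SUP_upper[OF q(1)])
  also have "\<dots> \<le> - primal_value \<nu> C"
    using y by (simp add: dual_solutions_eq_loss_conj_le)
  finally show ?thesis
    using loss_eq_log_lik[OF \<nu> q(2)] by (simp add: primal_value_eq[OF p])
qed

text \<open>Complementary slackness: one sign is polarity, the other is \<open>dual_solution_bound\<close> at \<open>q = p\<close>.\<close>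

lemma dual_solution_orthogonal:
  assumes p: "p \<in> primal_solutions \<nu> C" and y: "y \<in> dual_solutions \<nu> C"
  shows "p \<bullet> y = 0"
proof -
  have "p \<in> C" using p by (simp add: primal_solutions_def)
  then have "p \<bullet> y \<le> 0"
    using y by (simp add: dual_solutions_def polar_cone_def inner_commute)
  moreover have "0 \<le> p \<bullet> y"
    using dual_solution_bound[OF p y, of p] primal_solution_pos[OF p] \<open>p \<in> C\<close> subset by auto
  ultimately show ?thesis by simp
qed

text \<open>
  The first-order condition at \<open>p\<close> in the direction of the vertex of letter \<open>i\<close>. On a passive
  letter the quotient is \<open>0\<close> even when \<open>p $ i = 0\<close>, so the bound reads \<open>-1\<close> there.
\<close>

lemma dual_solution_lower_bound:
  assumes p: "p \<in> primal_solutions \<nu> C" and y: "y \<in> dual_solutions \<nu> C"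
  shows "\<nu> $ i / p $ i - 1 \<le> y $ i"
proof -
  let ?A = "active_letters \<nu>"
  let ?e = "axis i 1 :: real^'n"
  have pS: "p \<in> prob_simplex" using p subset by (auto simp: primal_solutions_def)
  have "(\<Sum>j\<in>?A. \<nu> $ j * (?e $ j / p $ j - 1)) \<le> y $ i"
  proof (rule first_order_condition)
    fix t :: real assume t: "0 < t" "t < 1"
    let ?r = "(1 - t) *\<^sub>R p + t *\<^sub>R ?e"
    have r: "?r \<in> prob_simplex"
      using t simplex_nonneg[OF pS] simplex_sum[OF pS]
      by (auto simp: prob_simplex_def sum.distrib sum_distrib_left[symmetric] axis_def)
    have pos: "0 < ?r $ j" if "j \<in> ?A" for j
      using t primal_solution_pos[OF p that] by (auto simp: axis_def add_pos_nonneg)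
    have "?r \<bullet> y = t * y $ i"
      using dual_solution_orthogonal[OF p y] by (simp add: inner_add_left inner_axis')
    then show "(\<Sum>j\<in>?A. \<nu> $ j * ln ((1 - t) * p $ j + t * ?e $ j)) - t * y $ i
        \<le> (\<Sum>j\<in>?A. \<nu> $ j * ln (p $ j))"
      using dual_solution_bound[OF p y r pos] by (simp add: log_lik_def)
  qed (use primal_solution_pos[OF p] simplex_nonneg[OF \<nu>] in \<open>auto simp: axis_def\<close>)
  moreover have "(\<Sum>j\<in>?A. \<nu> $ j * (?e $ j / p $ j)) = \<nu> $ i / p $ i"
  proof -
    have "(\<Sum>j\<in>?A. \<nu> $ j * (?e $ j / p $ j)) = (\<Sum>j\<in>UNIV. \<nu> $ j * (?e $ j / p $ j))"
      by (simp add: sum_split_letters[OF \<nu>] passive_letters_def)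
    also have "\<dots> = (\<Sum>j\<in>UNIV. if j = i then \<nu> $ i / p $ i else 0)"
      by (intro sum.cong) (auto simp: axis_def)
    finally show ?thesis by simp
  qed
  ultimately show ?thesis
    by (simp add: right_diff_distrib sum_subtractf sum_active_nu[OF \<nu>])
qed

text \<open>
  The nonnegative slacks \<open>y - (\<nu> / p - 1)\<close> have \<open>p\<close>-weighted sum
  \<open>\<langle>p, y\<rangle> - \<Sum> \<nu> + \<Sum> p = 0\<close>, so each slack vanishes where \<open>p > 0\<close>. This fixes all active
  coordinates and also the passive ones charged by \<open>p\<close>.
\<close>

lemma dual_solution_eq:
  assumes p: "p \<in> primal_solutions \<nu> C" and y: "y \<in> dual_solutions \<nu> C" and i: "0 < p $ i"
  shows "y $ i = \<nu> $ i / p $ i - 1"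
proof -
  let ?d = "\<lambda>i. p $ i * (y $ i - (\<nu> $ i / p $ i - 1))"
  have pS: "p \<in> prob_simplex" using p subset by (auto simp: primal_solutions_def)
  have d: "0 \<le> ?d i" for i
    using dual_solution_lower_bound[OF p y, of i] simplex_nonneg[OF pS, of i] by simp
  have "(\<Sum>i\<in>UNIV. ?d i) = (\<Sum>i\<in>UNIV. p $ i * y $ i - \<nu> $ i + p $ i)"
  proof (intro sum.cong refl)
    fix j
    \<comment> \<open>Cancelling \<open>p * (\<nu> / p)\<close> where \<open>p = 0\<close> is legitimate because \<open>\<nu> = 0\<close> at such letters.\<close>
    show "?d j = p $ j * y $ j - \<nu> $ j + p $ j"
    proof (cases "p $ j = 0")
      case True
      then have "\<nu> $ j = 0"
        using primal_solution_pos[OF p, of j] simplex_nonneg[OF \<nu>, of j]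
        by (force simp: active_letters_def)
      then show ?thesis using True by simp
    qed (simp add: algebra_simps)
  qed
  also have "\<dots> = p \<bullet> y"
    by (simp add: sum.distrib sum_subtractf inner_vec_def simplex_sum[OF pS] simplex_sum[OF \<nu>])
  also have "\<dots> = 0" by (rule dual_solution_orthogonal[OF p y])
  finally have "?d i = 0" using d by (subst (asm) sum_nonneg_eq_0_iff) auto
  then show ?thesis using i by simp
qed

lemma dual_solutions_iff:
  assumes p: "p \<in> primal_solutions \<nu> C"
  shows "y \<in> dual_solutions \<nu> C \<longleftrightarrow> y \<in> polar_cone C
    \<and> (\<forall>i\<in>active_letters \<nu>. y $ i = \<nu> $ i / p $ i - 1) \<and> (\<forall>i\<in>passive_letters \<nu>. -1 \<le> y $ i)"
proof
  assume y: "y \<in> dual_solutions \<nu> C"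
  have "-1 \<le> y $ i" if "i \<in> passive_letters \<nu>" for i
    using dual_solution_lower_bound[OF p y, of i] that by (simp add: passive_letters_def)
  with y show "y \<in> polar_cone C \<and> (\<forall>i\<in>active_letters \<nu>. y $ i = \<nu> $ i / p $ i - 1)
      \<and> (\<forall>i\<in>passive_letters \<nu>. -1 \<le> y $ i)"
    using dual_solution_eq[OF p y] primal_solution_pos[OF p] by (simp add: dual_solutions_def)
next
  assume "y \<in> polar_cone C \<and> (\<forall>i\<in>active_letters \<nu>. y $ i = \<nu> $ i / p $ i - 1)
      \<and> (\<forall>i\<in>passive_letters \<nu>. -1 \<le> y $ i)"
  then show "y \<in> dual_solutions \<nu> C"
    using loss_conj_le[OF p, of y] by (simp add: dual_solutions_eq_loss_conj_le)
qed

lemma dual_solutions_halfspaces: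
  assumes p: "p \<in> primal_solutions \<nu> C"
  shows "dual_solutions \<nu> C = (\<Inter>q\<in>C. {y. q \<bullet> y \<le> 0})
    \<inter> (\<Inter>i\<in>active_letters \<nu>. {y. axis i 1 \<bullet> y = \<nu> $ i / p $ i - 1})
    \<inter> (\<Inter>i\<in>passive_letters \<nu>. {y. axis i 1 \<bullet> y \<ge> -1})"
  by (simp add: set_eq_iff dual_solutions_iff[OF p] polar_cone_def inner_axis inner_commute conj_assoc)

lemma convex_dual_solutions: "convex (dual_solutions \<nu> C)"
proof -
  obtain p where p: "p \<in> primal_solutions \<nu> C" by (rule exists_primal_solution) blast
  show ?thesis
    unfolding dual_solutions_halfspaces[OF p]
    by (intro convex_Int convex_INT convex_halfspace_le convex_halfspace_ge convex_hyperplane)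
qed

text \<open>Every coordinate is at least \<open>-1\<close>, and pairing with a strictly positive \<open>q \<in> C\<close> bounds each
  coordinate from above: \<open>\<Sum> q (y + 1) = \<langle>q, y\<rangle> + 1 \<le> 1\<close> has nonnegative summands.\<close>

lemma compact_dual_solutions: "compact (dual_solutions \<nu> C)"
proof -
  obtain p where p: "p \<in> primal_solutions \<nu> C" by (rule exists_primal_solution) blast
  obtain q where q: "q \<in> C" "\<And>i. 0 < q $ i" by (rule positive_point) blast
  have lower: "-1 \<le> y $ i" if "y \<in> dual_solutions \<nu> C" for y i
    using that primal_solution_pos[OF p, of i] passive_eq_Compl_active[OF \<nu>]
    by (cases "i \<in> active_letters \<nu>")
       (auto simp: dual_solutions_iff[OF p] active_letters_def less_imp_le)
  have upper: "y $ i \<le> 1 / q $ i" if y: "y \<in> dual_solutions \<nu> C" for y i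
  proof -
    have "q $ i * (y $ i + 1) \<le> (\<Sum>j\<in>UNIV. q $ j * (y $ j + 1))"
    proof (rule member_le_sum)
      show "0 \<le> q $ j * (y $ j + 1)" for j
        using lower[OF y, of j] q(2)[of j] by simp
    qed auto
    also have "\<dots> = q \<bullet> y + 1"
      using simplex_sum[of q] q(1) subset
      by (auto simp: inner_vec_def distrib_left sum.distrib)
    also have "\<dots> \<le> 1"
      using y q(1) by (simp add: dual_solutions_def polar_cone_def inner_commute)
    finally have "y $ i + 1 \<le> 1 / q $ i"
      using q(2)[of i] by (simp add: field_simps)
    then show ?thesis by simp
  qed
  have "\<bar>y $ i\<bar> \<le> 1 + 1 / q $ i" if "y \<in> dual_solutions \<nu> C" for y i
  proof -
    have "0 < 1 / q $ i" using q(2) by simp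
    then show ?thesis using lower[OF that, of i] upper[OF that, of i] by linarith
  qed
  then have "bounded (dual_solutions \<nu> C)" by (rule bounded_if_coords_bounded)
  moreover have "closed (dual_solutions \<nu> C)"
    unfolding dual_solutions_halfspaces[OF p]
    by (intro closed_Int closed_INT ballI closed_halfspace_le closed_halfspace_ge closed_hyperplane)
  ultimately show ?thesis by (simp add: compact_eq_bounded_closed)
qed

section \<open>The two cases of active mass one and less than one\<close>

lemma dual_active_eq:
  assumes p: "p \<in> primal_solutions \<nu> C" and i: "i \<in> active_letters \<nu>"
  shows "dual_active \<nu> C i = \<nu> $ i / p $ i - 1"
  using i by (simp add: dual_active_def primal_active_eq[OF p] proj_on_def)

lemma sum_primal_active:
  assumes p: "p \<in> primal_solutions \<nu> C"
  shows "(\<Sum>i\<in>active_letters \<nu>. primal_active \<nu> C i) = (\<Sum>i\<in>active_letters \<nu>. p $ i)"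
    and "(\<Sum>i\<in>active_letters \<nu>. p $ i) + (\<Sum>i\<in>passive_letters \<nu>. p $ i) = 1"
proof -
  show "(\<Sum>i\<in>active_letters \<nu>. primal_active \<nu> C i) = (\<Sum>i\<in>active_letters \<nu>. p $ i)"
    by (simp add: primal_active_eq[OF p] proj_on_def)
  have "p \<in> prob_simplex" using p subset by (auto simp: primal_solutions_def)
  then show "(\<Sum>i\<in>active_letters \<nu>. p $ i) + (\<Sum>i\<in>passive_letters \<nu>. p $ i) = 1"
    using simplex_sum[of p] sum_split_letters[OF \<nu>, of "\<lambda>i. p $ i"] by simp
qed

lemma sum_primal_active_le: "(\<Sum>i\<in>active_letters \<nu>. primal_active \<nu> C i) \<le> 1"
proof -
  obtain p where p: "p \<in> primal_solutions \<nu> C" by (rule exists_primal_solution) blast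
  have "p \<in> prob_simplex" using p subset by (auto simp: primal_solutions_def)
  then have "0 \<le> (\<Sum>i\<in>passive_letters \<nu>. p $ i)"
    by (intro sum_nonneg simplex_nonneg)
  then show ?thesis using sum_primal_active[OF p] by simp
qed

lemma join_parts_in_dual_solutions:
  "join_parts \<nu> (dual_active \<nu> C) (\<lambda>i\<in>passive_letters \<nu>. -1) \<in> dual_solutions \<nu> C"
proof -
  obtain p where p: "p \<in> primal_solutions \<nu> C" by (rule exists_primal_solution) blast
  let ?y = "join_parts \<nu> (dual_active \<nu> C) (\<lambda>i\<in>passive_letters \<nu>. -1)"
  have ya: "?y $ i = \<nu> $ i / p $ i - 1" if "i \<in> active_letters \<nu>" for i
    using that by (simp add: join_parts_def dual_active_eq[OF p])
  have yp: "?y $ i = -1" if "i \<in> passive_letters \<nu>" for i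
    using that passive_eq_Compl_active[OF \<nu>] by (simp add: join_parts_def)
  show ?thesis
    using dual_candidate_in_polar[OF p ya yp] ya yp by (simp add: dual_solutions_iff[OF p])
qed

text \<open>At \<open>\<mu> = 1\<close> each summand is \<open>\<nu> / (\<nu> / p) = p\<close>; this is why the total active mass of the primal
  solution decides between \<open>\<mu> = 1\<close> and \<open>\<mu> < 1\<close>.\<close>

lemma mu_sum_at_one:
  assumes p: "p \<in> primal_solutions \<nu> C"
  shows "(\<Sum>i\<in>active_letters \<nu>. \<nu> $ i / (1 - - dual_active \<nu> C i))
    = (\<Sum>i\<in>active_letters \<nu>. primal_active \<nu> C i)"
  using primal_solution_pos[OF p]
  by (intro sum.cong)
     (auto simp: dual_active_eq[OF p] primal_active_eq[OF p] proj_on_def active_letters_def)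

lemma minus_dual_active_less_one:
  assumes "i \<in> active_letters \<nu>"
  shows "- dual_active \<nu> C i < 1"
proof -
  obtain p where p: "p \<in> primal_solutions \<nu> C" by (rule exists_primal_solution) blast
  have "0 < \<nu> $ i / p $ i"
    using assms primal_solution_pos[OF p assms] by (simp add: active_letters_def)
  then show ?thesis by (simp add: dual_active_eq[OF p assms])
qed

lemma mu_bar_dual_active:
  shows mu_bar_dual_active_eq: "(\<Sum>i\<in>active_letters \<nu>. primal_active \<nu> C i) = 1 \<Longrightarrow>
      mu_bar \<nu> (\<lambda>i\<in>active_letters \<nu>. - dual_active \<nu> C i) = 1"
    and mu_bar_dual_active_less: "(\<Sum>i\<in>active_letters \<nu>. primal_active \<nu> C i) < 1 \<Longrightarrow>
      mu_bar \<nu> (\<lambda>i\<in>active_letters \<nu>. - dual_active \<nu> C i) < 1"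
proof -
  let ?u = "\<lambda>i\<in>active_letters \<nu>. - dual_active \<nu> C i"
  obtain p where p: "p \<in> primal_solutions \<nu> C" by (rule exists_primal_solution) blast
  have sum: "(\<Sum>i\<in>active_letters \<nu>. \<nu> $ i / (1 - ?u i)) = (\<Sum>i\<in>active_letters \<nu>. primal_active \<nu> C i)"
    using mu_sum_at_one[OF p] by simp
  have less: "?u i < 1" if "i \<in> active_letters \<nu>" for i
    using minus_dual_active_less_one[OF that] that by simp
  show "mu_bar \<nu> ?u = 1" if "(\<Sum>i\<in>active_letters \<nu>. primal_active \<nu> C i) = 1"
    using that less sum by (intro mu_bar_eqI[OF \<nu>]) auto
  show "mu_bar \<nu> ?u < 1" if "(\<Sum>i\<in>active_letters \<nu>. primal_active \<nu> C i) < 1"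
    using that less sum by (intro mu_bar_less[OF \<nu>]) auto
qed

lemma dual_solutions_iff_min_coord:
  "y \<in> dual_solutions \<nu> C \<longleftrightarrow> y \<in> polar_cone C
    \<and> (\<forall>i\<in>active_letters \<nu>. y $ i = dual_active \<nu> C i)
    \<and> -1 \<le> min_coord (passive_letters \<nu>) (proj_on (passive_letters \<nu>) y)"
proof -
  obtain p where p: "p \<in> primal_solutions \<nu> C" by (rule exists_primal_solution) blast
  show ?thesis
    by (auto simp: dual_solutions_iff[OF p] dual_active_eq[OF p] min_coord_def proj_on_def
        le_INF_iff one_ereal_def)
qed

text \<open>The mass missing from the active letters sits on some passive letter, where \<open>dual_solution_eq\<close>
  applies with \<open>\<nu> = 0\<close>.\<close>

lemma passive_minus_one:
  assumes less: "(\<Sum>i\<in>active_letters \<nu>. primal_active \<nu> C i) < 1"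
    and y: "y \<in> dual_solutions \<nu> C"
  obtains i where "i \<in> passive_letters \<nu>" "y $ i = -1"
proof -
  obtain p where p: "p \<in> primal_solutions \<nu> C" by (rule exists_primal_solution) blast
  have "\<not> (\<Sum>i\<in>passive_letters \<nu>. p $ i) \<le> 0"
    using less sum_primal_active[OF p] by simp
  then obtain i where i: "i \<in> passive_letters \<nu>" "0 < p $ i"
    by (meson not_le sum_nonpos)
  have "y $ i = -1"
    using dual_solution_eq[OF p y i(2)] i(1) by (simp add: passive_letters_def)
  with i(1) show ?thesis by (rule that)
qed

lemma min_coord_dual_solution:
  assumes less: "(\<Sum>i\<in>active_letters \<nu>. primal_active \<nu> C i) < 1"
    and y: "y \<in> dual_solutions \<nu> C"
  shows "min_coord (passive_letters \<nu>) (proj_on (passive_letters \<nu>) y) = -1"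
proof (rule antisym)
  obtain i where i: "i \<in> passive_letters \<nu>" "y $ i = -1"
    by (rule passive_minus_one[OF less y])
  have "min_coord (passive_letters \<nu>) (proj_on (passive_letters \<nu>) y)
      \<le> ereal (proj_on (passive_letters \<nu>) y i)"
    unfolding min_coord_def by (rule INF_lower[OF i(1)])
  then show "min_coord (passive_letters \<nu>) (proj_on (passive_letters \<nu>) y) \<le> -1"
    using i by (simp add: proj_on_def one_ereal_def)
qed (use y dual_solutions_iff_min_coord in blast)

lemma max_coord_uminus:
  "max_coord I (proj_on I (- y)) = - min_coord I (proj_on I y)"
  unfolding max_coord_def min_coord_def
  by (simp add: proj_on_def ereal_INF_uminus_eq[symmetric] flip: ereal_SUP_uminus_eq)

lemma mu_hat_dual_solution:
  assumes y: "y \<in> dual_solutions \<nu> C"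
  shows "mu_hat \<nu> (- y) = 1"
proof -
  let ?A = "active_letters \<nu>" and ?P = "passive_letters \<nu>"
  have y': "\<forall>i\<in>?A. y $ i = dual_active \<nu> C i" "-1 \<le> min_coord ?P (proj_on ?P y)"
    using y dual_solutions_iff_min_coord by blast+
  have pr: "proj_on ?A (- y) = (\<lambda>i\<in>?A. - dual_active \<nu> C i)"
    using y'(1) by (auto simp: proj_on_def)
  show ?thesis
  proof (cases "(\<Sum>i\<in>?A. primal_active \<nu> C i) = 1")
    case True
    have "max_coord ?P (proj_on ?P (- y)) \<le> 1"
      using y'(2) by (simp add: max_coord_uminus ereal_uminus_le_reorder)
    then show ?thesis
      using mu_bar_dual_active_eq[OF True]
      by (simp add: mu_hat_def pr max_absorb1 one_ereal_def)
  next
    case False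
    then have less: "(\<Sum>i\<in>?A. primal_active \<nu> C i) < 1" using sum_primal_active_le by simp
    have "max_coord ?P (proj_on ?P (- y)) = 1"
      by (simp add: max_coord_uminus min_coord_dual_solution[OF less y])
    then show ?thesis
      using mu_bar_dual_active_less[OF less]
      by (simp add: mu_hat_def pr max_absorb2 one_ereal_def less_imp_le)
  qed
qed

lemma dual_solutions_eq_min_coord_ge:
  "dual_solutions \<nu> C = (\<lambda>(u, v). join_parts \<nu> u v) `
     ({dual_active \<nu> C} \<times>
      {v \<in> passive_slice \<nu> (polar_cone C) (dual_active \<nu> C). min_coord (passive_letters \<nu>) v \<ge> -1})"
  unfolding join_parts_image[OF \<nu>] using dual_solutions_iff_min_coord by blast

lemma dual_solutions_eq_min_coord_eq:
  assumes "(\<Sum>i\<in>active_letters \<nu>. primal_active \<nu> C i) < 1"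
  shows "dual_solutions \<nu> C = (\<lambda>(u, v). join_parts \<nu> u v) `
     ({dual_active \<nu> C} \<times>
      {v \<in> passive_slice \<nu> (polar_cone C) (dual_active \<nu> C). min_coord (passive_letters \<nu>) v = -1})"
  unfolding join_parts_image[OF \<nu>]
  using dual_solutions_iff_min_coord min_coord_dual_solution[OF assms] by force

end

section \<open>Fenchel duality\<close>

theorem theorem6:
  fixes \<nu> :: "real^'n" and C :: "(real^'n) set"
  assumes "\<nu> \<in> prob_simplex"
    and "convex C" and "closed C" and "C \<subseteq> prob_simplex"
    and "support_of C = UNIV"
  shows "dual_value \<nu> C = - primal_value \<nu> C
    \<and> dual_solutions \<nu> C \<noteq> {} \<and> convex (dual_solutions \<nu> C) \<and> compact (dual_solutions \<nu> C)
    \<and> (\<forall>y\<in>dual_solutions \<nu> C. mu_hat \<nu> (- y) = 1)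
    \<and> join_parts \<nu> (dual_active \<nu> C) (\<lambda>i\<in>passive_letters \<nu>. -1) \<in> dual_solutions \<nu> C
    \<and> ((\<Sum>i\<in>active_letters \<nu>. primal_active \<nu> C i) = 1 \<longrightarrow>
         mu_bar \<nu> (\<lambda>i\<in>active_letters \<nu>. - dual_active \<nu> C i) = 1
         \<and> dual_solutions \<nu> C =
             (\<lambda>(u, v). join_parts \<nu> u v) `
               ({dual_active \<nu> C} \<times>
                {v \<in> passive_slice \<nu> (polar_cone C) (dual_active \<nu> C).
                   min_coord (passive_letters \<nu>) v \<ge> -1}))
    \<and> ((\<Sum>i\<in>active_letters \<nu>. primal_active \<nu> C i) < 1 \<longrightarrow>
         mu_bar \<nu> (\<lambda>i\<in>active_letters \<nu>. - dual_active \<nu> C i) < 1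
         \<and> dual_solutions \<nu> C =
             (\<lambda>(u, v). join_parts \<nu> u v) `
               ({dual_active \<nu> C} \<times>
                {v \<in> passive_slice \<nu> (polar_cone C) (dual_active \<nu> C).
                   min_coord (passive_letters \<nu>) v = -1}))"
proof -
  interpret primal_problem \<nu> C
    using assms by unfold_locales
  show ?thesis
  proof (intro conjI impI ballI)
    show "dual_value \<nu> C = - primal_value \<nu> C" by (rule strong_duality)
    show "dual_solutions \<nu> C \<noteq> {}" using join_parts_in_dual_solutions by blast
    show "convex (dual_solutions \<nu> C)" by (rule convex_dual_solutions)
    show "compact (dual_solutions \<nu> C)" by (rule compact_dual_solutions)
    show "mu_hat \<nu> (- y) = 1" if "y \<in> dual_solutions \<nu> C" for y
      using that by (rule mu_hat_dual_solution)
  qed (rule join_parts_in_dual_solutions mu_bar_dual_active dual_solutions_eq_min_coord_ge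
      dual_solutions_eq_min_coord_eq; assumption?)+
qed

end
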